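(* Let the prior be $p=\mathcal N(0,I_d)$ and the noise distribution be $q=\mathcal N(0,\sigma^2I_{d_y})$ with $\sigma>0$. Let $\mathbb D_a$ and $\mathbb D_l$ be twice the expected KL divergences defined in the context, and set $\Delta_a=\widetilde A^\dagger-A^\dagger$ and $\Delta_l=A_l^\dagger-A^\dagger$ with $A^\dagger,\widetilde A^\dagger,A_l^\dagger,\Sigma,\Sigma_a,\Sigma_l$ as defined in the context. Then $$\mathbb D_a=\log\frac{|\Sigma|}{|\Sigma_a|}+\mathrm{Tr}(\Sigma^{-1}\Sigma_a)-d+\frac1{\sigma^2}\|A\Delta_aA\|_F^2+\sigma^2\|\Delta_a\|_F^2+\|\Delta_aA\|_F^2+\|A\Delta_a\|_F^2,$$ $$\mathbb D_l=\log\frac{|\Sigma|}{|\Sigma_l|}+\mathrm{Tr}(\Sigma^{-1}\Sigma_l)-d+\frac1{\sigma^2}\|A\Delta_lA\|_F^2+\sigma^2\|\Delta_l\|_F^2+\|\Delta_lA\|_F^2+\|A\Delta_l\|_F^2,$$ where $|\cdot|$ is the determinant and $\|\cdot\|_F$ the Frobenius norm.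
   Context: Setting. Let $d_y\le d$, let $O\in\mathbb{R}^{d_y\times d}$ have full rank, let $F,\widetilde F\in\mathbb{R}^{d\times d}$ be invertible, and set $A=OF$, $\widetilde A=O\widetilde F$. The model is $y=Ax+e$ with $x\sim p$ and $e\sim q$ independent. Define probability densities in $x\in\mathbb{R}^d$: $\pi(x|y)\propto q(y-Ax)p(x)$, $\pi_a(x|y)\propto q(y-\widetilde Ax)p(x)$, and $\pi_l(x|y)\propto q(y-Ax)\widetilde p(Fx)$ with $\widetilde p(u)=p(\widetilde F^{-1}u)|\det\widetilde F^{-1}|$. With the expectation over the marginal law of $y$ under the model, $$\mathbb D_a=2\,\mathbb E_y[\mathrm{KL}(\pi_a(\cdot|y)\,\|\,\pi(\cdot|y))],\qquad \mathbb D_l=2\,\mathbb E_y[\mathrm{KL}(\pi_l(\cdot|y)\,\|\,\pi(\cdot|y))].$$ Notation (here $\dagger$ is not the Moore–Penrose inverse but a regularized pseudo-inverse): $A^\dagger=A^\top(AA^\top+\sigma^2I)^{-1}$, $\widetilde A^\dagger=\widetilde A^\top(\widetilde A\widetilde A^\top+\sigma^2I)^{-1}$, $A_l^\dagger=F^{-1}\widetilde F\widetilde A^\dagger$; $\Sigma=I-A^\dagger A$, $\Sigma_a=I-\widetilde A^\dagger\widetilde A$, $\Sigma_l=F^{-1}\widetilde F\,\Sigma_a\,\widetilde F^\top F^{-\top}$. For Gaussian $p,q$ as in the claim, $\pi(\cdot|y)=\mathcal N(A^\dagger y,\Sigma)$, $\pi_a(\cdot|y)=\mathcal N(\widetilde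 A^\dagger y,\Sigma_a)$, $\pi_l(\cdot|y)=\mathcal N(A_l^\dagger y,\Sigma_l)$. *)

theory Defs
  imports "HOL-Probability.Probability"
begin

text \<open>
  A matrix with \<open>m\<close> rows and \<open>d\<close> columns has type \<open>real^'d^'m\<close>. On this type the library's
  \<open>norm\<close> is the Frobenius norm:
\<close>

lemma norm_eq_frobenius:
  fixes M :: "real^'n^'m"
  shows "norm M = sqrt (\<Sum>i\<in>UNIV. \<Sum>j\<in>UNIV. (M $ i $ j)\<^sup>2)"
  by (simp add: norm_vec_def L2_set_def sum_nonneg)

text \<open>The density of \<open>N(\<mu>, S)\<close> with respect to Lebesgue measure, for positive definite \<open>S\<close>.\<close>

definition mvn_density :: "real^'n \<Rightarrow> real^'n^'n \<Rightarrow> real^'n \<Rightarrow> real" where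
  "mvn_density \<mu> S x =
     exp (- ((x - \<mu>) \<bullet> (matrix_inv S *v (x - \<mu>))) / 2) / sqrt ((2 * pi) ^ CARD('n) * det S)"

text \<open>The density of \<open>M x\<close> when \<open>x\<close> has density \<open>p\<close> and \<open>M\<close> is invertible.\<close>

definition pushforward_density :: "real^'n^'n \<Rightarrow> (real^'n \<Rightarrow> real) \<Rightarrow> real^'n \<Rightarrow> real" where
  "pushforward_density M p u = p (matrix_inv M *v u) * \<bar>det (matrix_inv M)\<bar>"

definition posterior_density ::
  "(real^'m \<Rightarrow> real) \<Rightarrow> real^'d^'m \<Rightarrow> (real^'d \<Rightarrow> real) \<Rightarrow> real^'m \<Rightarrow> real^'d \<Rightarrow> real" where
  "posterior_density q A p y x =
     q (y - A *v x) * p x / (LINT x'|lborel. q (y - A *v x') * p x')"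

text \<open>The law of \<open>y = A x + e\<close> for independent \<open>x\<close> and \<open>e\<close> with densities \<open>p\<close> and \<open>q\<close>.\<close>

definition observation_law ::
  "(real^'m \<Rightarrow> real) \<Rightarrow> real^'d^'m \<Rightarrow> (real^'d \<Rightarrow> real) \<Rightarrow> (real^'m) measure" where
  "observation_law q A p =
     distr (density lborel p \<Otimes>\<^sub>M density lborel q) borel (\<lambda>(x, e). A *v x + e)"

text \<open>
  \<open>KL(f || g)\<close> in nats, for probability densities \<open>f\<close> and \<open>g\<close>. The library's
  \<open>KL_divergence b M N\<close> takes the reference measure first: it is the divergence of \<open>N\<close> from \<open>M\<close>,
  integrated over \<open>N\<close>.
\<close>

definition KL_density :: "(real^'d \<Rightarrow> real) \<Rightarrow> (real^'d \<Rightarrow> real) \<Rightarrow> real" where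
  "KL_density f g = KL_divergence (exp 1) (density lborel g) (density lborel f)"

definition twice_expected_KL ::
  "'y measure \<Rightarrow> ('y \<Rightarrow> real^'d \<Rightarrow> real) \<Rightarrow> ('y \<Rightarrow> real^'d \<Rightarrow> real) \<Rightarrow> real" where
  "twice_expected_KL Y f g = 2 * (LINT y|Y. KL_density (f y) (g y))"

text \<open>The regularized pseudo-inverse; \<open>mat c\<close> is \<open>c\<close> times the identity matrix.\<close>

definition reg_pinv :: "real \<Rightarrow> real^'d^'m \<Rightarrow> real^'m^'d" where
  "reg_pinv \<sigma> A = transpose A ** matrix_inv (A ** transpose A + mat (\<sigma>\<^sup>2))"

end

theory Submission
  imports Defs
begin

text \<open>
  All posteriors are Gaussian: completing the square with the posterior precision
  \<open>\<Lambda> = I + A\<^sup>T A / \<sigma>\<^sup>2\<close>, for which \<open>\<Lambda> A\<^sup>\<dagger> = A\<^sup>T / \<sigma>\<^sup>2\<close> and hence \<open>\<Lambda> \<Sigma> = I\<close>, identifies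
  \<open>\<pi>\<close> and \<open>\<pi>\<^sub>a\<close>; the substitution \<open>z = Ft\<^sup>-\<^sup>1 F x\<close> turns \<open>\<pi>\<^sub>l\<close> into \<open>\<pi>\<^sub>a\<close>. Twice the divergence of two
  Gaussians with mean difference \<open>\<Delta> y\<close> is a constant plus \<open>(\<Delta> y) \<bullet> \<Lambda> (\<Delta> y)\<close>. Since \<open>y\<close> has second
  moment \<open>A A\<^sup>T + \<sigma>\<^sup>2 I\<close>, the expectation of the quadratic form is
  \<open>Tr (\<Delta>\<^sup>T (I + A\<^sup>T A / \<sigma>\<^sup>2) \<Delta> (A A\<^sup>T + \<sigma>\<^sup>2 I))\<close>, whose four terms are the Frobenius norms.
\<close>

subsection \<open>Matrix algebra\<close>

lemma inner_matrix_vector_mult: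
  fixes A :: "real^'n^'m"
  shows "x \<bullet> (A *v y) = (transpose A *v x) \<bullet> y"
  by (simp add: dot_lmul_matrix[symmetric])

lemma inner_transpose_matrix_vector_mult:
  fixes A :: "real^'n^'m"
  shows "x \<bullet> (transpose A *v y) = (A *v x) \<bullet> y"
  by (simp only: inner_matrix_vector_mult transpose_transpose)

lemma matrix_add_rdistrib:
  fixes A B :: "real^'n^'m"
  shows "(A + B) ** C = A ** C + B ** C"
  by (simp add: matrix_matrix_mult_def vec_eq_iff sum.distrib distrib_right)

lemma matrix_inv_right:
  fixes A :: "real^'n^'m"
  assumes "invertible A"
  shows "A ** matrix_inv A = mat 1"
  using assms unfolding invertible_def matrix_inv_def by (rule someI2_ex) blast

lemma matrix_inv_left:
  fixes A :: "real^'n^'m"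
  assumes "invertible A"
  shows "matrix_inv A ** A = mat 1"
  using assms unfolding invertible_def matrix_inv_def by (rule someI2_ex) blast

lemma matrix_inv_eqI:
  fixes A B :: "real^'n^'n"
  assumes "A ** B = mat 1"
  shows "matrix_inv A = B"
proof -
  have "invertible A" using assms invertible_right_inverse by blast
  then have "matrix_inv A ** (A ** B) = B"
    by (simp add: matrix_mul_assoc matrix_inv_left)
  then show ?thesis by (simp add: assms)
qed

text \<open>Gram-Schmidt for the inner product given by \<open>Q\<close>. The index set is kept
  variable so that the induction can add one vector at a time; the cardinality bound leaves room for
  the next one.\<close>

lemma pos_def_orthonormal_family:
  fixes Q :: "real^'n^'n"
  assumes sym: "transpose Q = Q" and pos: "\<And>x. x \<noteq> 0 \<Longrightarrow> x \<bullet> (Q *v x) > 0"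
  assumes "finite I" "card I \<le> CARD('n)"
  shows "\<exists>f :: 'i \<Rightarrow> real^'n. \<forall>i\<in>I. \<forall>j\<in>I. f i \<bullet> (Q *v f j) = of_bool (i = j)"
  using assms(3,4)
proof (induction I)
  case (insert k I)
  then obtain f where f: "\<And>i j. i \<in> I \<Longrightarrow> j \<in> I \<Longrightarrow> f i \<bullet> (Q *v f j) = of_bool (i = j)"
    by auto
  \<comment> \<open>Euclidean orthogonality to all \<open>Q *v f i\<close> is orthogonality to all
    \<open>f i\<close> for the form. A nonzero such \<open>v\<close> exists because these images
    span fewer than \<open>CARD('n)\<close> dimensions.\<close>
  have "dim ((\<lambda>i. Q *v f i) ` I) \<le> card I"
    using insert.hyps by (meson card_image_le dim_le_card' finite_imageI order_trans)
  also have "\<dots> < CARD('n)" using insert by simp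
  finally obtain v where v: "v \<noteq> 0" and orth: "\<And>y. y \<in> span ((\<lambda>i. Q *v f i) ` I) \<Longrightarrow> orthogonal v y"
    using orthogonal_to_subspace_exists[of "(\<lambda>i. Q *v f i) ` I"] by auto
  have vQ: "v \<bullet> (Q *v f i) = 0" if "i \<in> I" for i
    using orth[OF span_base] that by (auto simp: orthogonal_def)
  have Qv: "f i \<bullet> (Q *v v) = 0" if "i \<in> I" for i
    using vQ[OF that] inner_matrix_vector_mult[of "f i" Q v] sym by (simp add: inner_commute)
  \<comment> \<open>This factor scales \<open>v\<close> to length 1 for the form.\<close>
  define c where "c = 1 / sqrt (v \<bullet> (Q *v v))"
  have "c * (c * (v \<bullet> (Q *v v))) = 1"
    using pos[OF v] by (simp add: c_def field_simps)
  then have "\<forall>i\<in>insert k I. \<forall>j\<in>insert k I. (f(k := c *\<^sub>R v)) i \<bullet> (Q *v (f(k := c *\<^sub>R v)) j) = of_bool (i = j)"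
    using insert.hyps f vQ Qv by (auto simp: matrix_vector_mult_scaleR)
  then show ?case by blast
qed simp

text \<open>The columns of \<open>P\<close> are a basis orthonormal for \<open>Q\<close>, so the
  entries of the congruent matrix are the products \<open>f i \<bullet> (Q *v f j)\<close>. This
  later factors a posterior covariance as \<open>R ** transpose R\<close>.\<close>

lemma pos_def_congruent_mat_1:
  fixes Q :: "real^'n^'n"
  assumes "transpose Q = Q" and "\<And>x. x \<noteq> 0 \<Longrightarrow> x \<bullet> (Q *v x) > 0"
  shows "\<exists>P :: real^'n^'n. transpose P ** Q ** P = mat 1"
proof -
  obtain f :: "'n \<Rightarrow> real^'n" where f: "\<And>i j. f i \<bullet> (Q *v f j) = of_bool (i = j)"
    using pos_def_orthonormal_family[OF assms, of "UNIV :: 'n set"] by auto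
  define P where "P = (\<chi> i j. f j $ i)"
  have "transpose P ** (Q ** P) = mat 1"
  proof (subst vec_eq_iff, intro allI, subst vec_eq_iff, intro allI)
    fix i j
    have "(transpose P ** (Q ** P)) $ i $ j = f i \<bullet> (Q *v f j)"
      by (simp add: matrix_matrix_mult_def transpose_def P_def inner_vec_def matrix_vector_mult_def)
    then show "(transpose P ** (Q ** P)) $ i $ j = mat 1 $ i $ j"
      by (simp add: f mat_def)
  qed
  then show ?thesis by (auto simp: matrix_mul_assoc)
qed

subsection \<open>Linear change of variables in Lebesgue measure\<close>

text \<open>By Tonelli, coordinate \<open>m\<close> is integrated first with all others fixed. Since
  \<open>n\<close> is among the fixed ones, the shear acts on that line as a translation, which
  leaves the integral unchanged.\<close>

lemma nn_integral_lborel_shear: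
  fixes f :: "real^'n \<Rightarrow> ennreal"
  assumes [measurable]: "f \<in> borel_measurable borel" and mn: "m \<noteq> n"
  shows "(\<integral>\<^sup>+x. f (x + (x $ n) *\<^sub>R axis m 1) \<partial>lborel) = (\<integral>\<^sup>+x. f x \<partial>lborel)"
proof -
  define B where "B = (Basis :: (real^'n) set) - {axis m 1}"
  \<comment> \<open>\<open>\<phi> g\<close> assembles the part of a vector that has no component
    along \<open>axis m 1\<close>.\<close>
  define \<phi> where "\<phi> g = (\<Sum>b\<in>B. g b *\<^sub>R b)" for g :: "real^'n \<Rightarrow> real"
  have B: "finite B" "axis m 1 \<notin> B" "insert (axis m 1) B = Basis"
    by (auto simp: B_def axis_in_Basis_iff)
  interpret product_sigma_finite "\<lambda>_ :: real^'n. lborel :: real measure" ..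
  have \<phi>_upd: "(\<Sum>b\<in>Basis. (g(axis m 1 := y)) b *\<^sub>R b) = y *\<^sub>R axis m 1 + \<phi> g" for g y
    unfolding B(3)[symmetric] \<phi>_def using B(1,2) by (auto intro!: sum.cong)
  have split: "(\<integral>\<^sup>+x. h x \<partial>lborel) = (\<integral>\<^sup>+g. (\<integral>\<^sup>+y. h (y *\<^sub>R axis m 1 + \<phi> g) \<partial>lborel) \<partial>Pi\<^sub>M B (\<lambda>_. lborel))"
    if [measurable]: "h \<in> borel_measurable borel" for h :: "real^'n \<Rightarrow> ennreal"
  proof -
    have "(\<integral>\<^sup>+x. h x \<partial>lborel) = (\<integral>\<^sup>+g. h (\<Sum>b\<in>Basis. g b *\<^sub>R b) \<partial>Pi\<^sub>M Basis (\<lambda>_. lborel))"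
      by (subst lborel_eq) (simp add: nn_integral_distr)
    also have "\<dots> = (\<integral>\<^sup>+g. h (\<Sum>b\<in>Basis. g b *\<^sub>R b) \<partial>Pi\<^sub>M (insert (axis m 1) B) (\<lambda>_. lborel))"
      by (simp only: B(3))
    also have "\<dots> = (\<integral>\<^sup>+g. (\<integral>\<^sup>+y. h (\<Sum>b\<in>Basis. (g(axis m 1 := y)) b *\<^sub>R b) \<partial>lborel) \<partial>Pi\<^sub>M B (\<lambda>_. lborel))"
      by (rule product_nn_integral_insert[OF B(1,2)]) (simp add: B(3))
    finally show ?thesis by (simp only: \<phi>_upd)
  qed
  have coord: "(y *\<^sub>R axis m 1 + \<phi> g) $ n = \<phi> g $ n" for y g
    using mn by (simp add: axis_def)
  have "(\<integral>\<^sup>+x. f (x + (x $ n) *\<^sub>R axis m 1) \<partial>lborel)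
      = (\<integral>\<^sup>+g. (\<integral>\<^sup>+y. f ((\<phi> g $ n + 1 * y) *\<^sub>R axis m 1 + \<phi> g) \<partial>lborel) \<partial>Pi\<^sub>M B (\<lambda>_. lborel))"
    by (subst split) (simp, simp only: coord, simp add: scaleR_add_left algebra_simps)
  \<comment> \<open>Translation invariance on the line; the factor 1 above gives the shift the
    affine form \<open>t + c * y\<close>.\<close>
  also have "\<dots> = (\<integral>\<^sup>+g. (\<integral>\<^sup>+y. f (y *\<^sub>R axis m 1 + \<phi> g) \<partial>lborel) \<partial>Pi\<^sub>M B (\<lambda>_. lborel))"
  proof (rule nn_integral_cong)
    fix g
    show "(\<integral>\<^sup>+y. f ((\<phi> g $ n + 1 * y) *\<^sub>R axis m 1 + \<phi> g) \<partial>lborel) = (\<integral>\<^sup>+y. f (y *\<^sub>R axis m 1 + \<phi> g) \<partial>lborel)"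
      by (subst nn_integral_real_affine[where f = "\<lambda>y. f (y *\<^sub>R axis m 1 + \<phi> g)" and c = 1 and t = "\<phi> g $ n"]) simp_all
  qed
  also have "\<dots> = (\<integral>\<^sup>+x. f x \<partial>lborel)"
    by (rule split[symmetric]) simp
  finally show ?thesis .
qed

text \<open>Lebesgue measure is determined by its values on boxes. Permuting coordinates turns a box
  into one with the same side lengths in another order, so the volume is kept.\<close>

lemma lborel_distr_permute:
  fixes p :: "'n::finite \<Rightarrow> 'n"
  assumes p: "p permutes UNIV"
  shows "distr lborel borel (\<lambda>x :: real^'n. \<chi> i. x $ p i) = lborel"
proof (rule lborel_eqI[symmetric])
  fix l u :: "real^'n"
  assume le: "\<And>b. b \<in> Basis \<Longrightarrow> l \<bullet> b \<le> u \<bullet> b"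
  let ?q = "inv p"
  have [measurable]: "(\<lambda>x :: real^'n. \<chi> i. x $ p i) \<in> borel_measurable borel"
    by (intro borel_measurable_continuous_onI continuous_intros)
  have eq: "(\<lambda>x. \<chi> i. x $ p i) -` box l u = box (\<chi> i. l $ ?q i) (\<chi> i. u $ ?q i)"
    using permutes_inverses[OF p] by (auto simp: mem_box_cart) metis+
  have bas: "(\<Prod>b\<in>Basis. g \<bullet> b) = (\<Prod>i\<in>UNIV. g $ i)" for g :: "real^'n"
  proof -
    have Basis: "(Basis :: (real^'n) set) = range (\<lambda>i. axis i 1)"
      by (auto simp: Basis_vec_def)
    have inj: "inj (\<lambda>i. axis i (1::real) :: real^'n)"
      by (auto simp: inj_on_def axis_eq_axis)
    show ?thesis
      unfolding Basis prod.reindex[OF inj] by (simp add: inner_axis)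
  qed
  have le': "\<And>b. b \<in> Basis \<Longrightarrow> (\<chi> i. l $ ?q i) \<bullet> b \<le> (\<chi> i. u $ ?q i) \<bullet> b"
  proof -
    have "l $ i \<le> u $ i" for i
      using le[of "axis i 1"] by (simp add: axis_in_Basis_iff inner_axis)
    then show "(\<chi> i. l $ ?q i) \<bullet> b \<le> (\<chi> i. u $ ?q i) \<bullet> b" if "b \<in> Basis" for b
      using that by (auto simp: Basis_vec_def inner_axis)
  qed
  have "emeasure (distr lborel borel (\<lambda>x :: real^'n. \<chi> i. x $ p i)) (box l u)
       = (\<Prod>b\<in>Basis. ((\<chi> i. u $ ?q i) - (\<chi> i. l $ ?q i) :: real^'n) \<bullet> b)"
    using le' by (simp add: emeasure_distr eq emeasure_lborel_box)
  also have "\<dots> = (\<Prod>i\<in>UNIV. (u - l) $ ?q i)" by (simp add: bas)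
  also have "\<dots> = (\<Prod>i\<in>UNIV. (u - l) $ i)"
    using prod.permute[OF permutes_inv[OF p], of "\<lambda>i. (u - l) $ i"] by (simp add: o_def)
  finally show "emeasure (distr lborel borel (\<lambda>x. \<chi> i. x $ p i)) (box l u) = (\<Prod>b\<in>Basis. (u - l) \<bullet> b)"
    by (simp add: bas)
qed simp

lemma borel_measurable_matrix_vector_mult [measurable (raw)]:
  fixes A :: "real^'n^'m"
  assumes "f \<in> borel_measurable M"
  shows "(\<lambda>x. A *v f x) \<in> borel_measurable M"
  using assms linear_continuous_on[OF matrix_vector_mul_bounded_linear]
  by (rule borel_measurable_continuous_on[rotated])

text \<open>
  The change of variables theorems of HOL-Analysis need a well-ordered index type; reduction to
  elementary matrices avoids the order.
\<close>

lemma nn_integral_lborel_linear: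
  fixes A :: "real^'n^'n" and f :: "real^'n \<Rightarrow> ennreal"
  assumes "f \<in> borel_measurable borel" "det A \<noteq> 0"
  shows "(\<integral>\<^sup>+x. f x \<partial>lborel) = ennreal \<bar>det A\<bar> * (\<integral>\<^sup>+x. f (A *v x) \<partial>lborel)"
proof -
  \<comment> \<open>Quantifying over \<open>f\<close> inside the property lets the product case use
    the hypothesis for \<open>B\<close> on \<open>f\<close> composed with \<open>A\<close>. The
    determinant condition is inside too, so the zero-row case is vacuous.\<close>
  define P where "P A \<longleftrightarrow> (det A \<noteq> 0 \<longrightarrow> (\<forall>f\<in>borel_measurable borel.
    (\<integral>\<^sup>+x. f x \<partial>lborel) = ennreal \<bar>det A\<bar> * (\<integral>\<^sup>+x. f (A *v x) \<partial>lborel)))" for A :: "real^'n^'n"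
  have PD: "(\<integral>\<^sup>+x. f x \<partial>lborel) = ennreal \<bar>det A\<bar> * (\<integral>\<^sup>+x. f (A *v x) \<partial>lborel)"
    if "P A" "det A \<noteq> 0" "f \<in> borel_measurable borel" for A :: "real^'n^'n" and f
    using that unfolding P_def by blast
  have "P A"
  proof (rule induct_matrix_elementary_alt)
    fix A B :: "real^'n^'n"
    assume A: "P A" and B: "P B"
    show "P (A ** B)"
      unfolding P_def
    proof (intro impI ballI)
      fix f :: "real^'n \<Rightarrow> ennreal" assume [measurable]: "f \<in> borel_measurable borel"
      assume "det (A ** B) \<noteq> 0"
      then have "det A \<noteq> 0" "det B \<noteq> 0" by (auto simp: det_mul)
      have "(\<integral>\<^sup>+x. f x \<partial>lborel) = ennreal \<bar>det A\<bar> * (\<integral>\<^sup>+x. f (A *v x) \<partial>lborel)"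
        by (rule PD[OF A \<open>det A \<noteq> 0\<close>]) measurable
      also have "(\<integral>\<^sup>+x. f (A *v x) \<partial>lborel) = ennreal \<bar>det B\<bar> * (\<integral>\<^sup>+x. f (A *v (B *v x)) \<partial>lborel)"
        by (rule PD[OF B \<open>det B \<noteq> 0\<close>]) measurable
      finally show "(\<integral>\<^sup>+x. f x \<partial>lborel) = ennreal \<bar>det (A ** B)\<bar> * (\<integral>\<^sup>+x. f (A ** B *v x) \<partial>lborel)"
        by (simp add: det_mul abs_mult ennreal_mult mult.assoc matrix_vector_mul_assoc)
    qed
  next
    fix A :: "real^'n^'n" and i
    assume "row i A = 0"
    then show "P A"
      unfolding P_def using det_zero_row(2) by blast
  next
    fix A :: "real^'n^'n"
    assume A: "\<And>i j. i \<noteq> j \<Longrightarrow> A $ i $ j = 0"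
    show "P A"
      unfolding P_def
    proof (intro impI ballI)
      fix f :: "real^'n \<Rightarrow> ennreal" assume [measurable]: "f \<in> borel_measurable borel"
      assume d: "det A \<noteq> 0"
      \<comment> \<open>\<open>c\<close> indexes the diagonal entries by basis vectors, the form in
        which \<open>lborel_affine_euclidean\<close> takes its scaling factors.\<close>
      define c where "c b = b \<bullet> (A *v b)" for b
      have c_axis: "c (axis i 1) = A $ i $ i" for i
        by (simp add: c_def inner_axis' matrix_vector_mult_basis column_def)
      have inj: "inj (\<lambda>i. axis i (1::real) :: real^'n)"
        by (auto simp: inj_on_def axis_eq_axis)
      have Basis: "(Basis :: (real^'n) set) = range (\<lambda>i. axis i 1)"
        by (auto simp: Basis_vec_def)
      have det: "(\<Prod>b\<in>Basis. \<bar>c b\<bar>) = \<bar>det A\<bar>"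
        unfolding Basis prod.reindex[OF inj] by (simp add: c_axis det_diagonal[of A, OF A] abs_prod)
      have nz: "c b \<noteq> 0" if "b \<in> Basis" for b
        using d that by (auto simp: Basis c_axis det_diagonal[of A, OF A])
      have T: "0 + (\<Sum>b\<in>Basis. (c b * (x \<bullet> b)) *\<^sub>R b) = A *v x" for x
      proof -
        have "(\<Sum>b\<in>Basis. (c b * (x \<bullet> b)) *\<^sub>R b) = (\<Sum>i\<in>UNIV. (A $ i $ i * x $ i) *\<^sub>R axis i 1)"
          unfolding Basis by (subst sum.reindex[OF inj]) (simp add: c_axis inner_axis)
        also have "\<dots> = A *v x"
        proof (rule vec_eq_iff[THEN iffD2], rule allI)
          fix k
          have "(A *v x) $ k = (\<Sum>j\<in>UNIV. if k = j then A $ k $ k * x $ k else 0)"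
            unfolding matrix_vector_mult_def by (simp only: vec_lambda_beta, intro sum.cong) (auto simp: A)
          then show "(\<Sum>i\<in>UNIV. (A $ i $ i * x $ i) *\<^sub>R axis i 1) $ k = (A *v x) $ k"
            by (simp add: axis_def if_distrib cong: if_cong)
        qed
        finally show ?thesis by simp
      qed
      show "(\<integral>\<^sup>+x. f x \<partial>lborel) = ennreal \<bar>det A\<bar> * (\<integral>\<^sup>+x. f (A *v x) \<partial>lborel)"
        by (subst lborel_affine_euclidean[where c = c and t = 0, OF nz])
           (simp_all only: T det, simp add: nn_integral_density nn_integral_distr nn_integral_cmult)
    qed
  next
    fix m n :: 'n assume "m \<noteq> n"
    let ?p = "Transposition.transpose m n"
    let ?A = "(\<chi> i j. mat 1 $ i $ ?p j) :: real^'n^'n"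
    have p: "?p permutes UNIV" by (rule permutes_swap_id) auto
    have det: "\<bar>det ?A\<bar> = 1"
      using \<open>m \<noteq> n\<close> by (simp add: det_permute_columns[OF p] sign_swap_id)
    have app: "?A *v x = (\<chi> i. x $ ?p i)" for x :: "real^'n"
    proof -
      \<comment> \<open>A transposition is its own inverse, so \<open>i = ?p j\<close> amounts to
        \<open>j = ?p i\<close>.\<close>
      have "mat 1 $ i $ ?p j = (if j = ?p i then 1 else 0 :: real)" for i j
        by (auto simp: mat_def)
      then show ?thesis
        by (simp only: matrix_vector_mult_def vec_lambda_beta) (simp add: vec_eq_iff mult_delta_left)
    qed
    have [measurable]: "(\<lambda>x :: real^'n. \<chi> i. x $ ?p i) \<in> borel_measurable borel"
      by (intro borel_measurable_continuous_onI continuous_intros)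
    show "P ?A"
      unfolding P_def det app
    proof (intro impI ballI)
      fix f :: "real^'n \<Rightarrow> ennreal" assume [measurable]: "f \<in> borel_measurable borel"
      have "(\<integral>\<^sup>+x. f x \<partial>lborel) = (\<integral>\<^sup>+x. f x \<partial>distr lborel borel (\<lambda>x. \<chi> i. x $ ?p i))"
        by (simp only: lborel_distr_permute[OF p])
      also have "\<dots> = (\<integral>\<^sup>+x. f (\<chi> i. x $ ?p i) \<partial>lborel)"
        by (simp add: nn_integral_distr)
      finally show "(\<integral>\<^sup>+x. f x \<partial>lborel) = ennreal 1 * (\<integral>\<^sup>+x. f (\<chi> i. x $ ?p i) \<partial>lborel)"
        by simp
    qed
  next
    fix m n :: 'n assume mn: "m \<noteq> n"
    let ?A = "(\<chi> i j. of_bool (i = m \<and> j = n \<or> i = j)) :: real^'n^'n"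
    \<comment> \<open>The shear matrix is the identity with row \<open>n\<close> added to row
      \<open>m\<close>, an operation that preserves the determinant.\<close>
    have "?A = (\<chi> k. if k = m then row m (mat 1) + 1 *s row n (mat 1) else row k (mat 1))"
      using mn by (auto simp: vec_eq_iff row_def mat_def)
    then have det: "det ?A = 1"
      using det_row_operation[OF mn, where A = "mat 1 :: real^'n^'n" and c = 1] by (simp only: det_I)
    have app: "?A *v x = x + (x $ n) *\<^sub>R axis m 1" for x :: "real^'n"
    proof -
      \<comment> \<open>The two ways for an entry to be 1 exclude each other because
        \<open>m\<close> and \<open>n\<close> differ, so the entry is a sum of two deltas.\<close>
      have "of_bool (i = m \<and> j = n \<or> i = j) * x $ j
          = (if j = i then x $ i else 0) + (if j = n then (if i = m then x $ n else 0) else 0)" for i j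
        using mn by auto
      then show ?thesis
        by (simp add: matrix_vector_mult_def vec_eq_iff sum.distrib axis_def)
    qed
    show "P ?A"
      unfolding P_def det app using nn_integral_lborel_shear[OF _ mn] by auto
  qed
  then show ?thesis using assms by (intro PD)
qed

subsection \<open>Gaussian measures\<close>

lemma has_bochner_integral_distrI:
  fixes f :: "'b \<Rightarrow> real"
  assumes "T \<in> measurable M N" "f \<in> borel_measurable N" "has_bochner_integral M (\<lambda>x. f (T x)) c"
  shows "has_bochner_integral (distr M N T) f c"
  using assms by (simp add: has_bochner_integral_iff integrable_distr_eq integral_distr)

text \<open>Lebesgue measure is the image of a product measure indexed by \<open>Basis\<close>,
  where Fubini factorises the integral. \<open>axis_index\<close> translates between basis vectors
  and indices.\<close>

lemma has_bochner_integral_lborel_prod_vec: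
  fixes h :: "'n::finite \<Rightarrow> real \<Rightarrow> real"
  assumes h: "\<And>i. has_bochner_integral lborel (h i) (c i)"
  shows "has_bochner_integral lborel (\<lambda>x :: real^'n. \<Prod>i\<in>UNIV. h i (x $ i)) (\<Prod>i\<in>UNIV. c i)"
proof -
  let ?B = "Basis :: (real^'n) set"
  let ?\<phi> = "\<lambda>g. \<Sum>b\<in>?B. g b *\<^sub>R b"
  interpret product_sigma_finite "\<lambda>_ :: real^'n. lborel :: real measure" ..
  have int: "integrable lborel (h i)" and c: "integral\<^sup>L lborel (h i) = c i" for i
    using h by (auto simp: has_bochner_integral_iff)
  have [measurable]: "h i \<in> borel_measurable borel" for i
    using int[of i] by auto
  have inj: "inj (\<lambda>i. axis i (1::real) :: real^'n)"
    by (auto simp: inj_on_def axis_eq_axis)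
  have B: "?B = range (\<lambda>i. axis i 1)"
    by (auto simp: Basis_vec_def)
  have \<phi>: "?\<phi> g $ i = g (axis i 1)" for g i
    unfolding B sum.reindex[OF inj] by (simp add: axis_def if_distrib cong: if_cong)
  have eq: "(\<Prod>i\<in>UNIV. h i (?\<phi> g $ i)) = (\<Prod>b\<in>?B. h (axis_index b) (g b))" for g
    unfolding \<phi> unfolding B prod.reindex[OF inj] by (simp add: axis_index_axis)
  have "integrable (Pi\<^sub>M ?B (\<lambda>_. lborel)) (\<lambda>g. \<Prod>b\<in>?B. h (axis_index b) (g b))"
    by (intro product_integrable_prod int) simp
  moreover have "(\<integral>g. (\<Prod>b\<in>?B. h (axis_index b) (g b)) \<partial>Pi\<^sub>M ?B (\<lambda>_. lborel)) = (\<Prod>i\<in>UNIV. c i)"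
    by (subst product_integral_prod) (auto intro!: int simp: c B prod.reindex[OF inj] axis_index_axis)
  ultimately have "has_bochner_integral (Pi\<^sub>M ?B (\<lambda>_. lborel)) (\<lambda>g. \<Prod>i\<in>UNIV. h i (?\<phi> g $ i)) (\<Prod>i\<in>UNIV. c i)"
    by (simp only: has_bochner_integral_iff eq)
  then show ?thesis
    by (subst lborel_eq, intro has_bochner_integral_distrI) measurable
qed

lemma inner_self_vec:
  fixes z :: "real^'n"
  shows "z \<bullet> z = (\<Sum>i\<in>UNIV. (z $ i)\<^sup>2)"
  by (simp add: inner_vec_def power2_eq_square)

lemma mvn_density_std:
  "mvn_density 0 (mat 1) (z :: real^'n) = (\<Prod>i\<in>UNIV. std_normal_density (z $ i))"
proof -
  have "matrix_inv (mat 1 :: real^'n^'n) = mat 1"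
    by (rule matrix_inv_eqI) simp
  then show ?thesis
    by (simp add: mvn_density_def std_normal_density_def inner_self_vec prod_dividef
      real_sqrt_power real_sqrt_mult power_mult_distrib exp_sum[symmetric] sum_negf sum_divide_distrib)
qed

text \<open>Density and monomial both factor over the coordinates, so every mixed moment is a
  product of one-dimensional ones. The exponents 0, one indicator and a sum of two indicators yield
  mass, mean and covariance below.\<close>

lemma std_gaussian_moment:
  fixes e :: "'n::finite \<Rightarrow> nat"
  shows "has_bochner_integral lborel (\<lambda>z :: real^'n. mvn_density 0 (mat 1) z * (\<Prod>i\<in>UNIV. (z $ i) ^ e i))
    (\<Prod>i\<in>UNIV. \<integral>t. std_normal_density t * t ^ e i \<partial>lborel)"
  unfolding mvn_density_std prod.distrib[symmetric]
  by (rule has_bochner_integral_lborel_prod_vec[where h = "\<lambda>i t. std_normal_density t * t ^ e i"])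
     (auto simp: has_bochner_integral_iff integrable_std_normal_moment)

lemma std_normal_moments:
  "(\<integral>t. std_normal_density t * t \<partial>lborel) = 0"
  "(\<integral>t. std_normal_density t * (t * t) \<partial>lborel) = 1"
  using integral_std_normal_moment_odd[of 0] integral_std_normal_moment_even[of 1]
  by (simp_all add: power2_eq_square)

lemma
  fixes i j :: "'n::finite"
  shows std_gaussian_total: "has_bochner_integral lborel (mvn_density (0 :: real^'n) (mat 1)) 1"
    and std_gaussian_mean: "has_bochner_integral lborel (\<lambda>z :: real^'n. mvn_density 0 (mat 1) z * z $ i) 0"
    and std_gaussian_cov: "has_bochner_integral lborel
      (\<lambda>z :: real^'n. mvn_density 0 (mat 1) z * (z $ i * z $ j)) (of_bool (i = j))"
proof -
  show "has_bochner_integral lborel (mvn_density (0 :: real^'n) (mat 1)) 1"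
    using std_gaussian_moment[of "\<lambda>_. 0"] by simp
  have *: "(\<Prod>k\<in>UNIV. a k ^ of_bool (k = i)) = a i" for a :: "'n \<Rightarrow> real" and i
    by (simp add: of_bool_def if_distrib cong: if_cong)
  \<comment> \<open>The zeroth moment is 1 and the first is 0; hence the mean below vanishes through
    its factor at \<open>k = i\<close>.\<close>
  have m: "(\<integral>t. std_normal_density t * t ^ of_bool b \<partial>lborel) = of_bool (\<not> b)" for b
    by (cases b) (simp_all add: std_normal_moments)
  show "has_bochner_integral lborel (\<lambda>z :: real^'n. mvn_density 0 (mat 1) z * z $ i) 0"
    using std_gaussian_moment[of "\<lambda>k. of_bool (k = i)"]
    unfolding * m by (subst (asm) prod_zero[of UNIV]) auto
  \<comment> \<open>The exponents of \<open>z $ i * z $ j\<close>: 2 at \<open>i\<close> if the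
    indices coincide, otherwise 1 at each.\<close>
  let ?e = "\<lambda>k. of_bool (k = i) + of_bool (k = j)"
  have "(\<Prod>k\<in>UNIV. a k ^ ?e k) = a i * a j" for a :: "'n \<Rightarrow> real"
    by (simp only: power_add prod.distrib *)
  moreover have "(\<Prod>k\<in>UNIV. \<integral>t. std_normal_density t * t ^ ?e k \<partial>lborel) = of_bool (i = j)"
  proof (cases "i = j")
    case True
    have "(\<integral>t. std_normal_density t * t ^ (of_bool b + of_bool b) \<partial>lborel) = 1" for b
      by (cases b) (simp_all add: std_normal_moments power2_eq_square)
    then show ?thesis using True by simp
  next
    case False
    then have "(\<integral>t. std_normal_density t * t ^ ?e i \<partial>lborel) = 0"
      by (simp add: std_normal_moments)
    then have "\<exists>k\<in>UNIV. (\<integral>t. std_normal_density t * t ^ ?e k \<partial>lborel) = 0"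
      by blast
    from prod_zero[OF finite this] show ?thesis using False by simp
  qed
  ultimately show "has_bochner_integral lborel
      (\<lambda>z :: real^'n. mvn_density 0 (mat 1) z * (z $ i * z $ j)) (of_bool (i = j))"
    using std_gaussian_moment[of ?e] by (simp only:)
qed

lemma borel_measurable_mvn_density [measurable]:
  "mvn_density \<mu> S \<in> borel_measurable borel"
  unfolding mvn_density_def[abs_def] by measurable

lemma mvn_density_nonneg: "0 \<le> det S \<Longrightarrow> 0 \<le> mvn_density \<mu> S x"
  by (simp add: mvn_density_def)

lemma mvn_density_pos: "0 < det S \<Longrightarrow> 0 < mvn_density \<mu> S x"
  by (simp add: mvn_density_def)

text \<open>The second moment matrix is the identity, so the quadratic part averages to the trace;
  the linear part averages to 0 and the constant keeps its value.\<close>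

lemma std_gaussian_quadratic:
  fixes K :: "real^'n^'n"
  shows "has_bochner_integral (density lborel (mvn_density 0 (mat 1))) (\<lambda>z. z \<bullet> (K *v z) + z \<bullet> b + c) (trace K + c)"
proof -
  let ?g = "mvn_density (0 :: real^'n) (mat 1)"
  have expand: "?g z *\<^sub>R (z \<bullet> (K *v z) + z \<bullet> b + c)
      = (\<Sum>i\<in>UNIV. \<Sum>j\<in>UNIV. K $ i $ j * (?g z * (z $ i * z $ j))) + (\<Sum>i\<in>UNIV. b $ i * (?g z * z $ i)) + c * ?g z" for z
    by (simp add: inner_vec_def matrix_vector_mult_def sum_distrib_left algebra_simps)
  have "has_bochner_integral lborel (\<lambda>z. ?g z *\<^sub>R (z \<bullet> (K *v z) + z \<bullet> b + c))
     ((\<Sum>i\<in>UNIV. \<Sum>j\<in>UNIV. K $ i $ j * of_bool (i = j)) + (\<Sum>i\<in>UNIV. b $ i * 0) + c * 1)"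
    unfolding expand
    by (intro has_bochner_integral_add has_bochner_integral_sum has_bochner_integral_mult_right
        std_gaussian_total std_gaussian_mean std_gaussian_cov)
  also have "(\<Sum>i\<in>UNIV. \<Sum>j\<in>UNIV. K $ i $ j * of_bool (i = j)) + (\<Sum>i\<in>UNIV. b $ i * 0) + c * 1 = trace K + c"
    by (simp add: trace_def of_bool_def if_distrib cong: if_cong)
  finally show ?thesis
    by (intro has_bochner_integral_density) (auto simp: mvn_density_nonneg)
qed

section \<open>Affine images of the standard Gaussian\<close>

lemma matrix_inv_mult_transpose:
  fixes P :: "real^'n^'n"
  assumes "invertible P"
  shows "matrix_inv (P ** transpose P) = transpose (matrix_inv P) ** matrix_inv P"
proof (rule matrix_inv_eqI)
  have "P ** transpose P ** (transpose (matrix_inv P) ** matrix_inv P)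
      = P ** transpose (matrix_inv P ** P) ** matrix_inv P"
    by (simp add: matrix_transpose_mul matrix_mul_assoc)
  then show "P ** transpose P ** (transpose (matrix_inv P) ** matrix_inv P) = mat 1"
    by (simp add: assms matrix_inv_left matrix_inv_right)
qed

lemma det_mult_transpose: "det (P ** transpose P) = (det (P :: real^'n^'n))\<^sup>2"
  by (simp add: det_mul power2_eq_square)

text \<open>The inverse covariance \<open>P^-T P^-1\<close> undoes \<open>P\<close> in the exponent,
  leaving \<open>z \<bullet> z\<close>, and the Jacobian cancels the square root of
  \<open>det (P ** transpose P)\<close>.\<close>

lemma mvn_density_affine:
  fixes P :: "real^'n^'n"
  assumes P: "invertible P"
  shows "\<bar>det P\<bar> * mvn_density \<mu> (P ** transpose P) (\<mu> + P *v z) = mvn_density 0 (mat 1) z"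
proof -
  have "matrix_inv (mat 1 :: real^'n^'n) = mat 1"
    by (rule matrix_inv_eqI) simp
  moreover have "(P *v z) \<bullet> (transpose (matrix_inv P) ** matrix_inv P *v (P *v z)) = z \<bullet> z"
  proof -
    have "matrix_inv P *v (P *v z) = z"
      by (simp add: matrix_vector_mul_assoc matrix_inv_left[OF P])
    then show ?thesis
      by (simp only: matrix_vector_mul_assoc[symmetric] inner_transpose_matrix_vector_mult)
  qed
  moreover have "det P \<noteq> 0"
    using P by (simp add: invertible_det_nz)
  ultimately show ?thesis
    by (simp add: mvn_density_def matrix_inv_mult_transpose[OF P] det_mult_transpose real_sqrt_mult)
qed

text \<open>Translation invariance followed by the linear change of variables. Expectations under
  any Gaussian with a factored covariance can thus be computed under the standard one.\<close>

lemma distr_std_gaussian_affine: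
  fixes P :: "real^'n^'n"
  assumes P: "invertible P"
  shows "distr (density lborel (mvn_density 0 (mat 1))) borel (\<lambda>z. \<mu> + P *v z)
    = density lborel (mvn_density \<mu> (P ** transpose P))" (is "_ = density lborel ?f")
proof (rule measure_eqI)
  fix X assume "X \<in> sets (distr (density lborel (mvn_density 0 (mat 1))) borel (\<lambda>z. \<mu> + P *v z))"
  then have [measurable]: "X \<in> sets borel" by simp
  have [measurable]: "(\<lambda>z. \<mu> + P *v z) -` X \<in> sets borel"
    by (rule measurable_sets_borel[of _ borel]) measurable
  have det: "det P \<noteq> 0" using P by (simp add: invertible_det_nz)
  \<comment> \<open>Lebesgue measure is rewritten as its own translate by \<open>\<mu>\<close>, so
    that the linear substitution can follow.\<close>
  have "emeasure (density lborel ?f) X = (\<integral>\<^sup>+x. ?f x * indicator X x \<partial>distr lborel borel ((+) \<mu>))"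
    by (subst lborel_distr_plus) (simp add: emeasure_density)
  also have "\<dots> = (\<integral>\<^sup>+x. ?f (\<mu> + x) * indicator X (\<mu> + x) \<partial>lborel)"
    by (simp add: nn_integral_distr)
  also have "\<dots> = ennreal \<bar>det P\<bar> * (\<integral>\<^sup>+z. ?f (\<mu> + P *v z) * indicator X (\<mu> + P *v z) \<partial>lborel)"
    by (rule nn_integral_lborel_linear[OF _ det]) measurable
  also have "\<dots> = (\<integral>\<^sup>+z. mvn_density 0 (mat 1) z * indicator X (\<mu> + P *v z) \<partial>lborel)"
    by (subst nn_integral_cmult[symmetric], measurable, intro nn_integral_cong)
       (simp only: ennreal_mult'[symmetric] abs_ge_zero mult.assoc[symmetric] mvn_density_affine[OF P],
        simp add: ennreal_mult' mvn_density_nonneg split: split_indicator)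
  also have "\<dots> = emeasure (distr (density lborel (mvn_density 0 (mat 1))) borel (\<lambda>z. \<mu> + P *v z)) X"
    by (simp add: emeasure_distr emeasure_density) (auto intro!: nn_integral_cong split: split_indicator)
  finally show "emeasure (distr (density lborel (mvn_density 0 (mat 1))) borel (\<lambda>z. \<mu> + P *v z)) X
    = emeasure (density lborel ?f) X" by simp
qed simp

lemma prob_space_gaussian:
  fixes P :: "real^'n^'n"
  assumes P: "invertible P"
  shows "prob_space (density lborel (mvn_density \<mu> (P ** transpose P)))"
proof -
  have "emeasure (density lborel (mvn_density (0::real^'n) (mat 1))) UNIV = ennreal 1"
    using std_gaussian_total[where 'n = 'n]
    by (simp add: emeasure_density has_bochner_integral_iff nn_integral_eq_integral mvn_density_nonneg)
  then interpret prob_space "density lborel (mvn_density (0::real^'n) (mat 1))"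
    by (intro prob_spaceI) simp
  show ?thesis
    unfolding distr_std_gaussian_affine[OF P, symmetric] by (rule prob_space_distr) simp
qed

text \<open>Substituting \<open>x = \<mu> + P *v z\<close> gives a quadratic polynomial in the
  standard Gaussian \<open>z\<close>; cyclicity of the trace moves \<open>P\<close> next to its
  transpose.\<close>

lemma gaussian_quadratic_form:
  fixes P M :: "real^'n^'n"
  assumes P: "invertible P"
  shows "has_bochner_integral (density lborel (mvn_density \<mu> (P ** transpose P)))
    (\<lambda>x. (x - a) \<bullet> (M *v (x - a))) (trace (M ** (P ** transpose P)) + (\<mu> - a) \<bullet> (M *v (\<mu> - a)))"
proof -
  define d where "d = \<mu> - a"
  \<comment> \<open>\<open>M\<close> may be asymmetric, so the linear coefficient collects both
    cross terms, one with \<open>M\<close> and one with its transpose.\<close>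
  let ?K = "transpose P ** M ** P" and ?b = "transpose P *v (M *v d + transpose M *v d)"
  have tr: "trace (M ** (P ** transpose P)) = trace ?K"
    using trace_mul_sym[of "M ** P" "transpose P"] by (simp add: matrix_mul_assoc)
  have eq: "(\<mu> + P *v z - a) \<bullet> (M *v (\<mu> + P *v z - a)) = z \<bullet> (?K *v z) + z \<bullet> ?b + d \<bullet> (M *v d)" for z
  proof -
    have d: "\<mu> + P *v z - a = d + P *v z" by (simp add: d_def)
    have "z \<bullet> (?K *v z) = (P *v z) \<bullet> (M *v (P *v z))"
      by (simp only: matrix_vector_mul_assoc[symmetric] inner_transpose_matrix_vector_mult)
    moreover have "z \<bullet> ?b = (P *v z) \<bullet> (M *v d) + d \<bullet> (M *v (P *v z))"
      by (simp only: inner_transpose_matrix_vector_mult inner_add_right) (simp only: inner_commute)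
    ultimately show ?thesis
      by (simp only: d matrix_vector_right_distrib inner_add_left inner_add_right)
  qed
  show ?thesis
    unfolding distr_std_gaussian_affine[OF P, symmetric] tr
    using std_gaussian_quadratic[of ?K ?b "d \<bullet> (M *v d)"]
    by (intro has_bochner_integral_distrI) (measurable, simp only: eq d_def)
qed

subsection \<open>Divergence and second moments\<close>

lemma invertible_mult_transpose:
  fixes P :: "real^'n^'n"
  shows "invertible P \<Longrightarrow> invertible (P ** transpose P)"
  by (intro invertible_mult transpose_invertible)

text \<open>The log ratio is a constant plus half the difference of two quadratic forms, each
  centred at its own mean. The factors \<open>P\<^sub>0\<close> and \<open>P\<^sub>1\<close> encode
  positive definiteness of the covariances.\<close>

lemma KL_density_gaussian:
  fixes P\<^sub>0 P\<^sub>1 :: "real^'n^'n"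
  assumes P0: "invertible P\<^sub>0" and P1: "invertible P\<^sub>1"
  defines "S\<^sub>0 \<equiv> P\<^sub>0 ** transpose P\<^sub>0" and "S\<^sub>1 \<equiv> P\<^sub>1 ** transpose P\<^sub>1"
  shows "KL_density (mvn_density \<mu>\<^sub>1 S\<^sub>1) (mvn_density \<mu>\<^sub>0 S\<^sub>0) =
    (ln (det S\<^sub>0 / det S\<^sub>1) + trace (matrix_inv S\<^sub>0 ** S\<^sub>1) - real CARD('n)
      + (\<mu>\<^sub>1 - \<mu>\<^sub>0) \<bullet> (matrix_inv S\<^sub>0 *v (\<mu>\<^sub>1 - \<mu>\<^sub>0))) / 2"
proof -
  let ?f = "mvn_density \<mu>\<^sub>1 S\<^sub>1" and ?g = "mvn_density \<mu>\<^sub>0 S\<^sub>0"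
  have det: "0 < det S\<^sub>0" "0 < det S\<^sub>1"
    using P0 P1 by (simp_all add: S\<^sub>0_def S\<^sub>1_def det_mult_transpose invertible_det_nz)
  have inv1: "matrix_inv S\<^sub>1 ** S\<^sub>1 = mat 1"
    unfolding S\<^sub>1_def using P1 by (intro matrix_inv_left invertible_mult_transpose)
  have ln_mvn: "ln (mvn_density \<mu> S x) =
      - ((x - \<mu>) \<bullet> (matrix_inv S *v (x - \<mu>))) / 2 - (ln ((2 * pi) ^ CARD('n)) + ln (det S)) / 2"
    if "0 < det S" for \<mu> x :: "real^'n" and S
    using that by (simp add: mvn_density_def ln_div ln_sqrt ln_mult)
  have log: "log (exp 1) (?f x / ?g x) = (ln (det S\<^sub>0 / det S\<^sub>1)
      + (x - \<mu>\<^sub>0) \<bullet> (matrix_inv S\<^sub>0 *v (x - \<mu>\<^sub>0)) - (x - \<mu>\<^sub>1) \<bullet> (matrix_inv S\<^sub>1 *v (x - \<mu>\<^sub>1))) / 2" for x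
  proof -
    have "log (exp 1) (?f x / ?g x) = ln (?f x) - ln (?g x)"
      using det by (simp add: log_def ln_divide_pos mvn_density_pos)
    moreover have "ln (det S\<^sub>0 / det S\<^sub>1) = ln (det S\<^sub>0) - ln (det S\<^sub>1)"
      using det by (rule ln_divide_pos)
    ultimately show ?thesis
      by (simp only: ln_mvn[OF det(1)] ln_mvn[OF det(2)]) (simp add: field_simps)
  qed
  \<comment> \<open>A reference density without zeros gives the absolute continuity required by
    \<open>KL_density_density\<close>.\<close>
  have "?g x \<noteq> 0" for x
    using mvn_density_pos[OF det(1)] by (metis less_irrefl)
  then have "KL_density ?f ?g = (\<integral>x. ?f x * log (exp 1) (?f x / ?g x) \<partial>lborel)"
    unfolding KL_density_def using det
    by (intro lborel.KL_density_density) (auto simp: mvn_density_nonneg)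
  also have "\<dots> = (\<integral>x. (ln (det S\<^sub>0 / det S\<^sub>1) + (x - \<mu>\<^sub>0) \<bullet> (matrix_inv S\<^sub>0 *v (x - \<mu>\<^sub>0))
      - (x - \<mu>\<^sub>1) \<bullet> (matrix_inv S\<^sub>1 *v (x - \<mu>\<^sub>1))) / 2 \<partial>density lborel ?f)"
    using det by (subst integral_density) (auto simp: mvn_density_nonneg log)
  \<comment> \<open>The second form is centred at the mean of the integrating Gaussian, so only the
    trace of the identity survives: this is the dimension.\<close>
  also have "\<dots> = (ln (det S\<^sub>0 / det S\<^sub>1) + (trace (matrix_inv S\<^sub>0 ** S\<^sub>1) + (\<mu>\<^sub>1 - \<mu>\<^sub>0) \<bullet> (matrix_inv S\<^sub>0 *v (\<mu>\<^sub>1 - \<mu>\<^sub>0)))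
      - (trace (matrix_inv S\<^sub>1 ** S\<^sub>1) + (\<mu>\<^sub>1 - \<mu>\<^sub>1) \<bullet> (matrix_inv S\<^sub>1 *v (\<mu>\<^sub>1 - \<mu>\<^sub>1)))) / 2"
  proof -
    interpret prob_space "density lborel ?f"
      unfolding S\<^sub>1_def by (rule prob_space_gaussian[OF P1])
    have const: "has_bochner_integral (density lborel ?f) (\<lambda>_. ln (det S\<^sub>0 / det S\<^sub>1)) (ln (det S\<^sub>0 / det S\<^sub>1))"
      using prob_space by (simp add: has_bochner_integral_iff)
    show ?thesis
      by (intro has_bochner_integral_integral_eq has_bochner_integral_divide_zero
          has_bochner_integral_diff has_bochner_integral_add const
          gaussian_quadratic_form[OF P1, folded S\<^sub>1_def])
  qed
  finally show ?thesis by (simp add: inv1 trace_I)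
qed

section \<open>Scalar matrices and second moments of the observation\<close>

lemma mat_eq_scaleR: "(mat c :: real^'n^'n) = c *\<^sub>R mat 1"
  by (simp add: mat_def vec_eq_iff)

lemma
  fixes A :: "real^'n^'m" and x :: "real^'n"
  shows mat_mult_left: "mat c ** A = c *\<^sub>R A"
    and mat_mult_right: "A ** mat c = c *\<^sub>R A"
    and mat_vector_mult: "mat c *v x = c *\<^sub>R x"
  using scalar_matrix_assoc[of c "mat 1" A] matrix_scalar_ac[of A c "mat 1"]
  by (simp_all add: mat_eq_scaleR[of c] scaleR_matrix_vector_assoc[symmetric])

lemma trace_scaleR: "trace (c *\<^sub>R A) = c * trace (A :: real^'n^'n)"
  by (simp add: trace_def sum_distrib_left)

lemma mat_power2_factor: "(mat (c\<^sup>2) :: real^'n^'n) = mat c ** transpose (mat c)"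
  by (simp add: mat_mult_left power2_eq_square) (simp add: mat_def vec_eq_iff)

lemma invertible_mat: "c \<noteq> 0 \<Longrightarrow> invertible (mat c :: real^'n^'n)"
  by (simp add: invertible_det_nz det_diagonal mat_def)

lemma prob_space_isotropic_gaussian:
  "\<sigma> \<noteq> 0 \<Longrightarrow> prob_space (density lborel (mvn_density \<mu> (mat (\<sigma>\<^sup>2) :: real^'n^'n)))"
  unfolding mat_power2_factor by (intro prob_space_gaussian invertible_mat)

lemma prob_space_std_gaussian: "prob_space (density lborel (mvn_density \<mu> (mat 1 :: real^'n^'n)))"
  using prob_space_isotropic_gaussian[of 1] by simp

text \<open>The form is averaged over the noise for fixed \<open>x\<close>, then over
  \<open>x\<close>. Its nonnegativity permits Tonelli on the product measure, and integrability
  follows from the finite value.\<close>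

lemma
  fixes A :: "real^'d^'m" and M :: "real^'m^'m"
  assumes \<sigma>: "\<sigma> \<noteq> 0"
  defines "Y \<equiv> observation_law (mvn_density 0 (mat (\<sigma>\<^sup>2))) A (mvn_density 0 (mat 1))"
  shows prob_space_observation_law: "prob_space Y"
    and observation_law_quadratic_form: "(\<And>y. 0 \<le> y \<bullet> (M *v y)) \<Longrightarrow>
      has_bochner_integral Y (\<lambda>y. y \<bullet> (M *v y)) (trace (M ** (A ** transpose A + mat (\<sigma>\<^sup>2))))"
proof -
  let ?X = "density lborel (mvn_density (0 :: real^'d) (mat 1))"
  let ?E = "density lborel (mvn_density (0 :: real^'m) (mat (\<sigma>\<^sup>2)))"
  interpret X: prob_space ?X by (rule prob_space_std_gaussian)
  interpret E: prob_space ?E by (rule prob_space_isotropic_gaussian[OF \<sigma>])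
  interpret XE: pair_prob_space ?X ?E ..
  have [measurable]: "(\<lambda>(x, e). A *v x + e) \<in> borel_measurable (?X \<Otimes>\<^sub>M ?E)"
    by measurable
  show "prob_space Y"
    unfolding Y_def observation_law_def by (rule XE.prob_space_distr) measurable
  assume nonneg: "\<And>y. 0 \<le> y \<bullet> (M *v y)"
  let ?K = "transpose A ** M ** A"
  have K: "x \<bullet> (?K *v x) = (A *v x) \<bullet> (M *v (A *v x))" for x
    by (simp only: matrix_vector_mul_assoc[symmetric] inner_transpose_matrix_vector_mult)
  have inner: "has_bochner_integral ?E (\<lambda>e. (A *v x + e) \<bullet> (M *v (A *v x + e))) (trace (M ** mat (\<sigma>\<^sup>2)) + x \<bullet> (?K *v x))" for x
    \<comment> \<open>Centring the form in \<open>e\<close> at \<open>- (A *v x)\<close> makes its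
      argument \<open>A *v x + e\<close>.\<close>
    using gaussian_quadratic_form[OF invertible_mat[OF \<sigma>], of 0 "- (A *v x)" M]
    unfolding mat_power2_factor[symmetric] by (simp add: K add.commute)
  have outer: "has_bochner_integral ?X (\<lambda>x. trace (M ** mat (\<sigma>\<^sup>2)) + x \<bullet> (?K *v x)) (trace ?K + trace (M ** mat (\<sigma>\<^sup>2)))"
    using std_gaussian_quadratic[of ?K 0 "trace (M ** mat (\<sigma>\<^sup>2))"] by (simp add: add.commute)
  have nonneg': "0 \<le> trace (M ** mat (\<sigma>\<^sup>2)) + x \<bullet> (?K *v x)" for x
    unfolding has_bochner_integral_integral_eq[OF inner, symmetric]
    by (rule Bochner_Integration.integral_nonneg) (rule nonneg)
  have "(\<integral>\<^sup>+y. y \<bullet> (M *v y) \<partial>Y) = (\<integral>\<^sup>+z. (case z of (x, e) \<Rightarrow> ennreal ((A *v x + e) \<bullet> (M *v (A *v x + e)))) \<partial>(?X \<Otimes>\<^sub>M ?E))"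
    unfolding Y_def observation_law_def by (subst nn_integral_distr) (auto simp: case_prod_unfold)
  also have "\<dots> = (\<integral>\<^sup>+x. \<integral>\<^sup>+e. ennreal ((A *v x + e) \<bullet> (M *v (A *v x + e))) \<partial>?E \<partial>?X)"
    by (subst E.nn_integral_fst[symmetric]) auto
  also have "\<dots> = (\<integral>\<^sup>+x. ennreal (trace (M ** mat (\<sigma>\<^sup>2)) + x \<bullet> (?K *v x)) \<partial>?X)"
    using inner nonneg by (intro nn_integral_cong) (simp add: has_bochner_integral_iff nn_integral_eq_integral)
  also have "\<dots> = ennreal (trace ?K + trace (M ** mat (\<sigma>\<^sup>2)))"
    using outer nonneg' by (simp add: has_bochner_integral_iff nn_integral_eq_integral)
  moreover have "0 \<le> trace ?K + trace (M ** mat (\<sigma>\<^sup>2))"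
    unfolding has_bochner_integral_integral_eq[OF outer, symmetric]
    by (rule Bochner_Integration.integral_nonneg) (rule nonneg')
  ultimately have "has_bochner_integral Y (\<lambda>y. y \<bullet> (M *v y)) (trace ?K + trace (M ** mat (\<sigma>\<^sup>2)))"
    using nonneg
    by (intro has_bochner_integral_nn_integral) (auto simp: Y_def observation_law_def)
  moreover have "trace ?K = trace (M ** (A ** transpose A))"
    using trace_mul_sym[of "transpose A" "M ** A"] by (simp add: matrix_mul_assoc)
  ultimately show "has_bochner_integral Y (\<lambda>y. y \<bullet> (M *v y)) (trace (M ** (A ** transpose A + mat (\<sigma>\<^sup>2))))"
    by (simp add: matrix_add_ldistrib trace_add)
qed

section \<open>Frobenius norms as traces\<close>

lemma norm_power2_matrix:
  fixes X :: "real^'n^'m"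
  shows "(norm X)\<^sup>2 = trace (transpose X ** X)"
  unfolding norm_eq_frobenius trace_def matrix_matrix_mult_def transpose_def
  by (subst sum.swap) (simp add: sum_nonneg power2_eq_square)

text \<open>The last factor is the second moment matrix of \<open>y\<close>, so this evaluates the
  expected squared length of \<open>X *v y\<close>. Used with \<open>\<Delta>\<close> and with
  \<open>A ** \<Delta>\<close> as \<open>X\<close>, it yields the four norms of the claim.\<close>

lemma trace_gram_observation_covariance:
  fixes A :: "real^'d^'m" and X :: "real^'m^'k"
  shows "trace (transpose X ** X ** (A ** transpose A + mat (\<sigma>\<^sup>2))) = (norm (X ** A))\<^sup>2 + \<sigma>\<^sup>2 * (norm X)\<^sup>2"
proof -
  have "trace (transpose X ** X ** (A ** transpose A)) = trace (transpose (X ** A) ** (X ** A))"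
    using trace_mul_sym[of "transpose X ** X ** A" "transpose A"]
    by (simp add: matrix_mul_assoc matrix_transpose_mul)
  then show ?thesis
    by (simp add: norm_power2_matrix matrix_add_ldistrib trace_add mat_mult_right trace_scaleR)
qed

subsection \<open>Gaussian posteriors\<close>

text \<open>The normalising integral equals \<open>C\<close> because \<open>f\<close> has total mass
  1, so identifying a posterior only takes proportionality in \<open>x\<close>.\<close>

lemma posterior_density_eqI:
  assumes eq: "\<And>x. q (y - A *v x) * p x = C * f x" and "C \<noteq> 0"
    and "(\<integral>x. f x \<partial>lborel) = 1"
  shows "posterior_density q A p y = f"
  using assms by (simp add: posterior_density_def fun_eq_iff)

text \<open>Prior precision plus the precision contributed by the data. It is the inverse of the
  posterior covariance, written without any matrix inverse.\<close>

definition posterior_precision :: "real \<Rightarrow> real^'d^'m \<Rightarrow> real^'d^'d" where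
  "posterior_precision \<sigma> A = mat 1 + (1 / \<sigma>\<^sup>2) *\<^sub>R (transpose A ** A)"

context
  fixes \<sigma> :: real and A :: "real^'d^'m"
  assumes \<sigma>: "\<sigma> \<noteq> 0"
begin

lemma inner_posterior_precision:
  "x \<bullet> (posterior_precision \<sigma> A *v x) = x \<bullet> x + (1 / \<sigma>\<^sup>2) * ((A *v x) \<bullet> (A *v x))"
  by (simp add: posterior_precision_def matrix_vector_mult_add_rdistrib inner_add_right
      scaleR_matrix_vector_assoc[symmetric])
     (simp only: matrix_vector_mul_assoc[symmetric] inner_transpose_matrix_vector_mult, simp)

lemma transpose_posterior_precision: "transpose (posterior_precision \<sigma> A) = posterior_precision \<sigma> A"
  by (simp add: posterior_precision_def transpose_def matrix_matrix_mult_def vec_eq_iff mat_def mult.commute eq_commute)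

text \<open>The quadratic form of this matrix is \<open>|A^T x|^2 + \<sigma>^2 |x|^2\<close>, which
  vanishes only at 0, so the kernel is trivial.\<close>

lemma gram_plus_mat_invertible: "invertible (A ** transpose A + mat (\<sigma>\<^sup>2))"
proof -
  have "x = 0" if "(A ** transpose A + mat (\<sigma>\<^sup>2)) *v x = 0" for x
  proof -
    have "x \<bullet> ((A ** transpose A + mat (\<sigma>\<^sup>2)) *v x) = (transpose A *v x) \<bullet> (transpose A *v x) + \<sigma>\<^sup>2 * (x \<bullet> x)"
      by (simp only: matrix_vector_mult_add_rdistrib matrix_vector_mul_assoc[symmetric] inner_add_right
          inner_matrix_vector_mult[of x A] mat_vector_mult inner_scaleR_right)
    then have "(transpose A *v x) \<bullet> (transpose A *v x) + \<sigma>\<^sup>2 * (x \<bullet> x) = 0"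
      by (simp only: that inner_zero_right)
    then have "\<sigma>\<^sup>2 * (x \<bullet> x) \<le> 0"
      using inner_ge_zero[of "transpose A *v x"] by linarith
    then have "x \<bullet> x \<le> 0"
      using \<sigma> by (simp add: mult_le_0_iff)
    then show ?thesis
      using inner_gt_zero_iff[of x] by linarith
  qed
  then show ?thesis
    by (simp add: invertible_left_inverse matrix_left_invertible_ker)
qed

lemma posterior_precision_reg_pinv:
  "posterior_precision \<sigma> A ** reg_pinv \<sigma> A = (1 / \<sigma>\<^sup>2) *\<^sub>R transpose A"
proof -
  let ?K = "A ** transpose A + mat (\<sigma>\<^sup>2)"
  \<comment> \<open>Both sides are \<open>\<sigma>^2 A^T + A^T A A^T\<close>; multiplying by the
    inverse of \<open>?K\<close> on the right then produces \<open>reg_pinv\<close>.\<close>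
  have "\<sigma>\<^sup>2 *\<^sub>R (posterior_precision \<sigma> A ** transpose A) = transpose A ** ?K"
    using \<sigma> by (simp add: posterior_precision_def matrix_add_rdistrib matrix_add_ldistrib
        mat_mult_right matrix_mul_assoc scaleR_add_right scalar_matrix_assoc[symmetric] add.commute)
  then have "posterior_precision \<sigma> A ** transpose A = (1 / \<sigma>\<^sup>2) *\<^sub>R (transpose A ** ?K)"
    using \<sigma> by (metis (no_types, lifting) power_not_zero divide_self_if scaleR_one scaleR_scaleR times_divide_eq_left mult_1)
  then have "posterior_precision \<sigma> A ** reg_pinv \<sigma> A = (1 / \<sigma>\<^sup>2) *\<^sub>R (transpose A ** (?K ** matrix_inv ?K))"
    by (simp add: reg_pinv_def matrix_mul_assoc scalar_matrix_assoc)
  then show ?thesis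
    by (simp add: matrix_inv_right[OF gram_plus_mat_invertible])
qed

lemma posterior_precision_covariance:
  "posterior_precision \<sigma> A ** (mat 1 - reg_pinv \<sigma> A ** A) = mat 1"
proof -
  have "posterior_precision \<sigma> A ** (reg_pinv \<sigma> A ** A) = (1 / \<sigma>\<^sup>2) *\<^sub>R (transpose A ** A)"
    by (simp add: matrix_mul_assoc posterior_precision_reg_pinv scalar_matrix_assoc)
  then show ?thesis
    using matrix_add_ldistrib[of "posterior_precision \<sigma> A" "mat 1 - reg_pinv \<sigma> A ** A" "reg_pinv \<sigma> A ** A"]
    by (simp add: posterior_precision_def)
qed

text \<open>The precision is positive definite, so it is congruent to the identity through some
  \<open>R\<close>. Then \<open>R ** transpose R\<close> inverts it, as does the covariance, and
  inverses are unique.\<close>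

lemma posterior_covariance_factor:
  "\<exists>R :: real^'d^'d. invertible R \<and> mat 1 - reg_pinv \<sigma> A ** A = R ** transpose R"
proof -
  let ?\<Lambda> = "posterior_precision \<sigma> A"
  have "0 < x \<bullet> (?\<Lambda> *v x)" if "x \<noteq> 0" for x
  proof -
    have "0 < x \<bullet> x" using that by simp
    moreover have "0 \<le> (1 / \<sigma>\<^sup>2) * ((A *v x) \<bullet> (A *v x))" by simp
    ultimately show ?thesis unfolding inner_posterior_precision by linarith
  qed
  then obtain R :: "real^'d^'d" where R: "transpose R ** ?\<Lambda> ** R = mat 1"
    using pos_def_congruent_mat_1[OF transpose_posterior_precision] by blast
  then have "invertible R"
    using invertible_left_inverse by blast
  \<comment> \<open>For square matrices the left inverse \<open>transpose R\<close> of
    \<open>?\<Lambda> ** R\<close> is also a right inverse.\<close>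
  moreover have "?\<Lambda> ** (R ** transpose R) = mat 1"
    using R matrix_left_right_inverse[of "transpose R" "?\<Lambda> ** R"] by (simp add: matrix_mul_assoc)
  then have "mat 1 - reg_pinv \<sigma> A ** A = R ** transpose R"
    using matrix_inv_eqI[OF posterior_precision_covariance] by (simp only: matrix_inv_eqI)
  ultimately show ?thesis by blast
qed

text \<open>Completing the square: the linear terms agree because the precision maps
  \<open>m\<close> to \<open>A^T y / \<sigma>^2\<close>. The last bracket is free of
  \<open>z\<close> and is absorbed by normalisation.\<close>

lemma posterior_exponent:
  fixes z :: "real^'d" and y :: "real^'m"
  defines "m \<equiv> reg_pinv \<sigma> A *v y"
  shows "(1 / \<sigma>\<^sup>2) * ((y - A *v z) \<bullet> (y - A *v z)) + z \<bullet> z =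
    (z - m) \<bullet> (posterior_precision \<sigma> A *v (z - m)) + ((1 / \<sigma>\<^sup>2) * (y \<bullet> y) - m \<bullet> (posterior_precision \<sigma> A *v m))"
proof -
  let ?\<Lambda> = "posterior_precision \<sigma> A"
  have zm: "z \<bullet> (?\<Lambda> *v m) = (1 / \<sigma>\<^sup>2) * ((A *v z) \<bullet> y)"
    unfolding m_def matrix_vector_mul_assoc posterior_precision_reg_pinv scaleR_matrix_vector_assoc[symmetric]
      inner_scaleR_right inner_transpose_matrix_vector_mult ..
  have mz: "m \<bullet> (?\<Lambda> *v z) = z \<bullet> (?\<Lambda> *v m)"
    using inner_matrix_vector_mult[of m ?\<Lambda> z] unfolding transpose_posterior_precision by (simp add: inner_commute)
  show ?thesis
    by (simp add: matrix_vector_mult_diff_distrib inner_diff_left inner_diff_right mz)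
       (simp add: inner_posterior_precision zm inner_commute algebra_simps add_divide_distrib diff_divide_distrib)
qed

text \<open>A linear change of variables \<open>z = G x\<close> reduces any Gaussian prior to the standard one.\<close>

lemma posterior_density_gaussian:
  fixes G H R :: "real^'d^'d" and y :: "real^'m"
  assumes HG: "H ** G = mat 1" and "c \<noteq> 0"
    and r: "\<And>x. r x = c * mvn_density 0 (mat 1) (G *v x)"
    and R: "mat 1 - reg_pinv \<sigma> A ** A = R ** transpose R" "invertible R"
  shows "posterior_density (mvn_density 0 (mat (\<sigma>\<^sup>2))) (A ** G) r y =
    mvn_density (H ** reg_pinv \<sigma> A *v y) (H ** R ** transpose (H ** R))"
proof -
  let ?\<Lambda> = "posterior_precision \<sigma> A" and ?S = "H ** R ** transpose (H ** R)"
  let ?m = "reg_pinv \<sigma> A *v y"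
  have GH: "G ** H = mat 1" using HG by (simp add: matrix_left_right_inverse)
  have HR: "invertible (H ** R)"
    using GH HG R(2) by (intro invertible_mult) (auto simp: invertible_def)
  have \<Lambda>R: "?\<Lambda> ** R ** transpose R = mat 1"
    using posterior_precision_covariance unfolding R(1) by (simp add: matrix_mul_assoc)
  have inv: "matrix_inv ?S = transpose G ** ?\<Lambda> ** G"
  proof (rule matrix_inv_eqI, subst matrix_left_right_inverse)
    have "transpose G ** ?\<Lambda> ** G ** ?S = transpose G ** (?\<Lambda> ** (G ** H) ** R ** transpose R) ** transpose H"
      by (simp add: matrix_mul_assoc matrix_transpose_mul)
    also have "\<dots> = transpose (H ** G)"
      by (simp add: GH \<Lambda>R matrix_transpose_mul)
    finally show "transpose G ** ?\<Lambda> ** G ** ?S = mat 1" by (simp add: HG)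
  qed
  have q_inv: "matrix_inv (mat (\<sigma>\<^sup>2) :: real^'m^'m) = mat (1 / \<sigma>\<^sup>2)"
    using \<sigma> by (intro matrix_inv_eqI) (simp add: mat_mult_left, simp add: mat_def vec_eq_iff)
  have p_inv: "matrix_inv (mat 1 :: real^'d^'d) = mat 1"
    by (rule matrix_inv_eqI) simp
  \<comment> \<open>\<open>G\<close> maps the deviation from the mean in \<open>x\<close> to the
    deviation \<open>G *v x - ?m\<close> in the coordinate with standard prior.\<close>
  have exponent: "(x - H ** reg_pinv \<sigma> A *v y) \<bullet> (matrix_inv ?S *v (x - H ** reg_pinv \<sigma> A *v y))
     = (G *v x - ?m) \<bullet> (?\<Lambda> *v (G *v x - ?m))" for x
  proof -
    have "G *v (x - H ** reg_pinv \<sigma> A *v y) = G *v x - ?m"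
      by (simp add: matrix_vector_mult_diff_distrib matrix_vector_mul_assoc matrix_mul_assoc GH)
    then show ?thesis
      unfolding inv by (simp only: matrix_vector_mul_assoc[symmetric] inner_transpose_matrix_vector_mult)
  qed
  have det: "0 < det ?S"
    using HR by (simp add: det_mult_transpose invertible_det_nz)
  have det\<sigma>: "0 < det (mat (\<sigma>\<^sup>2) :: real^'m^'m)"
    using \<sigma> invertible_mat[of \<sigma>, where 'n = 'm]
    unfolding mat_power2_factor det_mult_transpose by (simp add: invertible_det_nz)
  \<comment> \<open>\<open>a\<close>, \<open>b\<close> and \<open>s\<close> normalise the noise, the
    standard Gaussian in \<open>G *v x\<close> and the claimed posterior.\<close>
  define a where "a = sqrt ((2 * pi) ^ CARD('m) * det (mat (\<sigma>\<^sup>2) :: real^'m^'m))"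
  define b where "b = sqrt ((2 * pi) ^ CARD('d) * det (mat 1 :: real^'d^'d))"
  define s where "s = sqrt ((2 * pi) ^ CARD('d) * det ?S)"
  have abs: "a \<noteq> 0" "b \<noteq> 0" "s \<noteq> 0"
    using det det\<sigma> by (simp_all add: a_def b_def s_def)
  \<comment> \<open>Here \<open>e\<^sub>1\<close> and \<open>e\<^sub>2\<close> stand for the noise
    and prior exponentials, \<open>e\<^sub>3\<close> for the posterior one and
    \<open>e\<^sub>4\<close> for the factor depending on \<open>y\<close> alone.\<close>
  have rearrange: "e\<^sub>1 / a * (c * (e\<^sub>2 / b)) = c * e\<^sub>4 * s / (a * b) * (e\<^sub>3 / s)"
    if "e\<^sub>1 * e\<^sub>2 = e\<^sub>3 * e\<^sub>4" for e\<^sub>1 e\<^sub>2 e\<^sub>3 e\<^sub>4 :: real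
  proof -
    have "e\<^sub>1 / a * (c * (e\<^sub>2 / b)) = c / (a * b) * (e\<^sub>1 * e\<^sub>2)" by simp
    also have "\<dots> = c * e\<^sub>4 * s / (a * b) * (e\<^sub>3 / s)" using abs(3) that by simp
    finally show ?thesis .
  qed
  define \<kappa> where "\<kappa> = (1 / \<sigma>\<^sup>2) * (y \<bullet> y) - ?m \<bullet> (?\<Lambda> *v ?m)"
  show ?thesis
  proof (rule posterior_density_eqI[where C = "c * exp (- \<kappa> / 2) * s / (a * b)"])
    fix x
    let ?w = "y - A *v (G *v x)"
    have "?w \<bullet> (mat (1 / \<sigma>\<^sup>2) *v ?w) + (G *v x) \<bullet> (G *v x)
        = (G *v x - ?m) \<bullet> (?\<Lambda> *v (G *v x - ?m)) + \<kappa>"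
      using posterior_exponent[of y "G *v x"] by (simp add: mat_vector_mult \<kappa>_def)
    then have "- (?w \<bullet> (mat (1 / \<sigma>\<^sup>2) *v ?w)) / 2 + - ((G *v x) \<bullet> (G *v x)) / 2
        = - ((G *v x - ?m) \<bullet> (?\<Lambda> *v (G *v x - ?m))) / 2 + - \<kappa> / 2"
      by linarith
    then have "exp (- (?w \<bullet> (mat (1 / \<sigma>\<^sup>2) *v ?w)) / 2) * exp (- ((G *v x) \<bullet> (G *v x)) / 2)
        = exp (- ((G *v x - ?m) \<bullet> (?\<Lambda> *v (G *v x - ?m))) / 2) * exp (- \<kappa> / 2)"
      by (simp only: exp_add[symmetric])
    then show "mvn_density 0 (mat (\<sigma>\<^sup>2)) (y - A ** G *v x) * r x =
        c * exp (- \<kappa> / 2) * s / (a * b) * mvn_density (H ** reg_pinv \<sigma> A *v y) ?S x"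
      unfolding mvn_density_def r exponent a_def[symmetric] b_def[symmetric] s_def[symmetric]
        q_inv p_inv matrix_vector_mul_lid diff_zero matrix_vector_mul_assoc[of A G, symmetric]
      by (rule rearrange)
  next
    show "c * exp (- \<kappa> / 2) * s / (a * b) \<noteq> 0"
      using abs \<open>c \<noteq> 0\<close> by simp
  next
    interpret prob_space "density lborel (mvn_density (H ** reg_pinv \<sigma> A *v y) ?S)"
      by (rule prob_space_gaussian[OF HR])
    have "(\<integral>x. 1 \<partial>density lborel (mvn_density (H ** reg_pinv \<sigma> A *v y) ?S))
        = (\<integral>x. mvn_density (H ** reg_pinv \<sigma> A *v y) ?S x *\<^sub>R (1 :: real) \<partial>lborel)"
      by (rule integral_density) (use det in \<open>auto simp: mvn_density_nonneg\<close>)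
    then show "(\<integral>x. mvn_density (H ** reg_pinv \<sigma> A *v y) ?S x \<partial>lborel) = 1"
      using prob_space by simp
  qed
qed

text \<open>Serves both approximations: each posterior has a mean \<open>N *v y\<close> linear in
  \<open>y\<close> and a covariance \<open>S\<close> independent of \<open>y\<close>. Only the
  quadratic form in \<open>\<Delta> *v y\<close> then has to be averaged.\<close>

lemma twice_expected_KL_linear_gaussian:
  fixes N :: "real^'m^'d" and P R :: "real^'d^'d"
  assumes P: "invertible P" "S = P ** transpose P"
    and R: "mat 1 - reg_pinv \<sigma> A ** A = R ** transpose R" "invertible R"
  defines "\<Sigma> \<equiv> mat 1 - reg_pinv \<sigma> A ** A" and "\<Delta> \<equiv> N - reg_pinv \<sigma> A"
  shows "twice_expected_KL (observation_law (mvn_density 0 (mat (\<sigma>\<^sup>2))) A (mvn_density 0 (mat 1)))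
      (\<lambda>y. mvn_density (N *v y) S) (\<lambda>y. mvn_density (reg_pinv \<sigma> A *v y) \<Sigma>) =
    ln (det \<Sigma> / det S) + trace (matrix_inv \<Sigma> ** S) - real CARD('d)
      + 1 / \<sigma>\<^sup>2 * (norm (A ** \<Delta> ** A))\<^sup>2 + \<sigma>\<^sup>2 * (norm \<Delta>)\<^sup>2
      + (norm (\<Delta> ** A))\<^sup>2 + (norm (A ** \<Delta>))\<^sup>2"
proof -
  let ?\<Lambda> = "posterior_precision \<sigma> A"
  let ?Y = "observation_law (mvn_density 0 (mat (\<sigma>\<^sup>2))) A (mvn_density 0 (mat 1))"
  let ?M = "transpose \<Delta> ** ?\<Lambda> ** \<Delta>"
  define k where "k = ln (det \<Sigma> / det S) + trace (matrix_inv \<Sigma> ** S) - real CARD('d)"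
  interpret Y: prob_space ?Y by (rule prob_space_observation_law[OF \<sigma>])
  have "?\<Lambda> ** \<Sigma> = mat 1"
    unfolding \<Sigma>_def by (rule posterior_precision_covariance)
  then have inv: "matrix_inv \<Sigma> = ?\<Lambda>"
    by (simp add: matrix_inv_eqI matrix_left_right_inverse)
  have M: "(\<Delta> *v y) \<bullet> (?\<Lambda> *v (\<Delta> *v y)) = y \<bullet> (?M *v y)" for y
    by (simp only: matrix_vector_mul_assoc[symmetric] inner_transpose_matrix_vector_mult)
  have KL: "KL_density (mvn_density (N *v y) S) (mvn_density (reg_pinv \<sigma> A *v y) \<Sigma>) = (k + y \<bullet> (?M *v y)) / 2" for y
    using KL_density_gaussian[OF R(2) P(1), of "N *v y" "reg_pinv \<sigma> A *v y"]
    unfolding R(1)[symmetric] P(2)[symmetric] \<Sigma>_def[symmetric] matrix_vector_mult_diff_rdistrib[symmetric]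
      \<Delta>_def[symmetric] inv M k_def .
  have "0 \<le> y \<bullet> (?M *v y)" for y
    unfolding M[symmetric] inner_posterior_precision by simp
  from observation_law_quadratic_form[OF \<sigma> this]
  have "has_bochner_integral ?Y (\<lambda>y. y \<bullet> (?M *v y)) (trace (?M ** (A ** transpose A + mat (\<sigma>\<^sup>2))))" .
  moreover have "has_bochner_integral ?Y (\<lambda>_. k) k"
    by (simp add: has_bochner_integral_iff Y.prob_space)
  ultimately have "has_bochner_integral ?Y (\<lambda>y. (k + y \<bullet> (?M *v y)) / 2)
      ((k + trace (?M ** (A ** transpose A + mat (\<sigma>\<^sup>2)))) / 2)"
    by (intro has_bochner_integral_divide_zero has_bochner_integral_add)
  then have "twice_expected_KL ?Y (\<lambda>y. mvn_density (N *v y) S) (\<lambda>y. mvn_density (reg_pinv \<sigma> A *v y) \<Sigma>)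
      = k + trace (?M ** (A ** transpose A + mat (\<sigma>\<^sup>2)))"
    by (simp add: twice_expected_KL_def KL has_bochner_integral_iff)
  \<comment> \<open>\<open>?M\<close> splits into the Gram matrices of \<open>\<Delta>\<close> and
    \<open>A ** \<Delta>\<close>, the latter scaled by \<open>1 / \<sigma>^2\<close>. That factor
    finally cancels the \<open>\<sigma>^2\<close> in front of the squared norm of
    \<open>A ** \<Delta>\<close>.\<close>
  also have "?M = transpose \<Delta> ** \<Delta> + (1 / \<sigma>\<^sup>2) *\<^sub>R (transpose (A ** \<Delta>) ** (A ** \<Delta>))"
    by (simp add: posterior_precision_def matrix_add_ldistrib matrix_add_rdistrib matrix_scalar_ac
        scalar_matrix_assoc[symmetric] matrix_transpose_mul matrix_mul_assoc)
  also have "trace (\<dots> ** (A ** transpose A + mat (\<sigma>\<^sup>2)))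
      = ((norm (\<Delta> ** A))\<^sup>2 + \<sigma>\<^sup>2 * (norm \<Delta>)\<^sup>2) + 1 / \<sigma>\<^sup>2 * ((norm (A ** \<Delta> ** A))\<^sup>2 + \<sigma>\<^sup>2 * (norm (A ** \<Delta>))\<^sup>2)"
    unfolding trace_gram_observation_covariance[symmetric]
    by (simp only: matrix_add_rdistrib trace_add scalar_matrix_assoc[symmetric] trace_scaleR)
  finally show ?thesis
    using \<sigma> by (simp add: k_def distrib_left)
qed

end

theorem proposition3p2:
  fixes Obs :: "real^'d^'m" and F Ft :: "real^'d^'d" and \<sigma> :: real
  assumes dim: "CARD('m) \<le> CARD('d)"
    and full_rank: "rank Obs = CARD('m)"
    and inv_F: "invertible F" and inv_Ft: "invertible Ft"
    and sigma: "\<sigma> > 0"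
  defines "A \<equiv> Obs ** F" and "At \<equiv> Obs ** Ft"
  defines "p \<equiv> mvn_density (0 :: real^'d) (mat 1)"
    and "q \<equiv> mvn_density (0 :: real^'m) (mat (\<sigma>\<^sup>2))"
  defines "pt \<equiv> pushforward_density Ft p"
  defines "post \<equiv> posterior_density q A p"
    and "post_a \<equiv> posterior_density q At p"
    and "post_l \<equiv> posterior_density q A (\<lambda>x. pt (F *v x))"
  defines "D_a \<equiv> twice_expected_KL (observation_law q A p) post_a post"
    and "D_l \<equiv> twice_expected_KL (observation_law q A p) post_l post"
  defines "Ad \<equiv> reg_pinv \<sigma> A" and "Atd \<equiv> reg_pinv \<sigma> At"
  defines "Ald \<equiv> matrix_inv F ** Ft ** Atd"
  defines "\<Sigma> \<equiv> mat 1 - Ad ** A" and "\<Sigma>a \<equiv> mat 1 - Atd ** At"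
  defines "\<Sigma>l \<equiv> matrix_inv F ** Ft ** \<Sigma>a ** transpose Ft ** transpose (matrix_inv F)"
  defines "\<Delta>a \<equiv> Atd - Ad" and "\<Delta>l \<equiv> Ald - Ad"
  shows "D_a = ln (det \<Sigma> / det \<Sigma>a) + trace (matrix_inv \<Sigma> ** \<Sigma>a) - real CARD('d)
            + 1 / \<sigma>\<^sup>2 * (norm (A ** \<Delta>a ** A))\<^sup>2 + \<sigma>\<^sup>2 * (norm \<Delta>a)\<^sup>2
            + (norm (\<Delta>a ** A))\<^sup>2 + (norm (A ** \<Delta>a))\<^sup>2
       \<and> D_l = ln (det \<Sigma> / det \<Sigma>l) + trace (matrix_inv \<Sigma> ** \<Sigma>l) - real CARD('d)
            + 1 / \<sigma>\<^sup>2 * (norm (A ** \<Delta>l ** A))\<^sup>2 + \<sigma>\<^sup>2 * (norm \<Delta>l)\<^sup>2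
            + (norm (\<Delta>l ** A))\<^sup>2 + (norm (A ** \<Delta>l))\<^sup>2"
proof
  have \<sigma>: "\<sigma> \<noteq> 0" using sigma by simp
  obtain R :: "real^'d^'d" where R: "invertible R" "\<Sigma> = R ** transpose R"
    using posterior_covariance_factor[OF \<sigma>, of A] unfolding \<Sigma>_def Ad_def by blast
  obtain Ra :: "real^'d^'d" where Ra: "invertible Ra" "\<Sigma>a = Ra ** transpose Ra"
    using posterior_covariance_factor[OF \<sigma>, of At] unfolding \<Sigma>a_def Atd_def by blast
  \<comment> \<open>In the coordinate \<open>z = ?G *v x\<close> one has
    \<open>A *v x = At *v z\<close>, and \<open>z\<close> has a standard Gaussian prior under the
    pushed-forward density. So \<open>\<pi>_l\<close> is \<open>\<pi>_a\<close> in \<open>z\<close>,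
    and \<open>?H\<close> transports it back.\<close>
  let ?G = "matrix_inv Ft ** F" and ?H = "matrix_inv F ** Ft"
  have HG: "?H ** ?G = mat 1"
  proof -
    have "?H ** ?G = matrix_inv F ** (Ft ** matrix_inv Ft) ** F"
      by (simp only: matrix_mul_assoc)
    then show ?thesis
      by (simp add: matrix_inv_right[OF inv_Ft] matrix_inv_left[OF inv_F])
  qed
  have AtG: "At ** ?G = A"
  proof -
    have "At ** ?G = Obs ** (Ft ** matrix_inv Ft) ** F"
      by (simp only: At_def matrix_mul_assoc)
    then show ?thesis
      by (simp add: A_def matrix_inv_right[OF inv_Ft])
  qed
  \<comment> \<open>The prior is already standard here, so \<open>G\<close> and \<open>H\<close> are
    the identity and \<open>c\<close> is 1.\<close>
  have post: "post = (\<lambda>y. mvn_density (Ad *v y) \<Sigma>)"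
  proof
    fix y
    show "post y = mvn_density (Ad *v y) \<Sigma>"
      using posterior_density_gaussian[OF \<sigma>, of "mat 1 :: real^'d^'d" "mat 1 :: real^'d^'d" 1 p A R y] R
      unfolding post_def q_def p_def Ad_def \<Sigma>_def by simp
  qed
  have post_a: "post_a = (\<lambda>y. mvn_density (Atd *v y) \<Sigma>a)"
  proof
    fix y
    show "post_a y = mvn_density (Atd *v y) \<Sigma>a"
      using posterior_density_gaussian[OF \<sigma>, of "mat 1 :: real^'d^'d" "mat 1 :: real^'d^'d" 1 p At Ra y] Ra
      unfolding post_a_def q_def p_def Atd_def \<Sigma>a_def by simp
  qed
  have \<Sigma>l: "\<Sigma>l = ?H ** Ra ** transpose (?H ** Ra)"
    by (simp add: \<Sigma>l_def Ra(2) matrix_transpose_mul matrix_mul_assoc)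
  have det: "\<bar>det (matrix_inv Ft)\<bar> \<noteq> 0"
    using matrix_inv_left[OF inv_Ft] by (metis abs_eq_0 det_I det_mul mult_zero_left zero_neq_one)
  \<comment> \<open>The Jacobian of the pushforward plays the part of \<open>c\<close>; being
    constant in \<open>x\<close>, it disappears on normalisation.\<close>
  have r: "pt (F *v x) = \<bar>det (matrix_inv Ft)\<bar> * mvn_density 0 (mat 1) (?G *v x)" for x
    by (simp add: pt_def pushforward_density_def p_def matrix_vector_mul_assoc)
  have post_l: "post_l = (\<lambda>y. mvn_density (Ald *v y) \<Sigma>l)"
    using posterior_density_gaussian[OF \<sigma> HG det r Ra(2)[unfolded \<Sigma>a_def Atd_def] Ra(1)]
    unfolding AtG \<Sigma>l post_l_def q_def Ald_def Atd_def by (rule ext)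
  have HRa: "invertible (?H ** Ra)"
  proof (rule invertible_mult[OF _ Ra(1)])
    show "invertible ?H" using HG invertible_right_inverse by blast
  qed
  show "D_a = ln (det \<Sigma> / det \<Sigma>a) + trace (matrix_inv \<Sigma> ** \<Sigma>a) - real CARD('d)
      + 1 / \<sigma>\<^sup>2 * (norm (A ** \<Delta>a ** A))\<^sup>2 + \<sigma>\<^sup>2 * (norm \<Delta>a)\<^sup>2
      + (norm (\<Delta>a ** A))\<^sup>2 + (norm (A ** \<Delta>a))\<^sup>2"
    unfolding D_a_def post post_a q_def p_def \<Delta>a_def
    using twice_expected_KL_linear_gaussian[OF \<sigma> Ra R(2)[unfolded \<Sigma>_def Ad_def] R(1), of Atd]
    unfolding \<Sigma>_def Ad_def .
  show "D_l = ln (det \<Sigma> / det \<Sigma>l) + trace (matrix_inv \<Sigma> ** \<Sigma>l) - real CARD('d)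
      + 1 / \<sigma>\<^sup>2 * (norm (A ** \<Delta>l ** A))\<^sup>2 + \<sigma>\<^sup>2 * (norm \<Delta>l)\<^sup>2
      + (norm (\<Delta>l ** A))\<^sup>2 + (norm (A ** \<Delta>l))\<^sup>2"
    unfolding D_l_def post post_l q_def p_def \<Delta>l_def
    using twice_expected_KL_linear_gaussian[OF \<sigma> HRa \<Sigma>l R(2)[unfolded \<Sigma>_def Ad_def] R(1), of Ald]
    unfolding \<Sigma>_def Ad_def .
qed

end
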